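(* Let $\alpha>0$ be fixed. For each $\beta>0$ let $g_\beta(v)=\frac\alpha2(v_1^2+v_2^2)+\beta|v_1v_2|_0$ for $v\in\mathbb{R}^2$, $U=L^2(D;\mathbb{R}^2)$, $\mathcal{G}_\beta(u)=\int_D g_\beta(u(x))\,dx$, and let $(u_\beta,p_\beta)\in U\times U$ satisfy $$p_\beta=-S^*(Su_\beta-z),\qquad u_\beta\in\partial\mathcal{G}_\beta^*(p_\beta).$$ Let $\mathcal{I}_\beta=\{x\in D:p_\beta(x)\in Q_0\cup Q_{10}\cup Q_{20}\}$ (the free arc), where the sets $Q_0,Q_{10},Q_{20}$ depend on $\alpha,\beta$. If $V\hookrightarrow L^\infty(D;\mathbb{R}^2)$ continuously, then there exists $\beta_0>0$ such that $|\mathcal{I}_\beta|=0$ for all $\beta\ge\beta_0$.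
   Context: $D\subset\mathbb{R}^d$ ($d\ge1$) is a measurable set of finite Lebesgue measure (so that $\mathcal{G}_\beta:U\to\mathbb{R}$ is real-valued). $Y$ is a real Hilbert space identified with its dual, $z\in Y$ is given, and $S:U\to Y$ is a bounded linear operator with adjoint $S^*:Y\to U$; $V$ is a Banach space continuously embedded in $L^r(D;\mathbb{R}^2)$ for some $r>2$ such that $S^*$ maps $Y$ continuously into $V$. $D,Y,z,S,V$ do not depend on $\beta$. $|t|_0=1$ if $t\ne0$ and $|0|_0=0$. $\mathcal{G}_\beta^*(p)=\sup_{u\in U}\langle u,p\rangle_U-\mathcal{G}_\beta(u)$ is the Fenchel conjugate on $U$ (identified with its dual) and $\partial\mathcal{G}_\beta^*$ its convex subdifferential. $|A|$ denotes the Lebesgue measure of $A\subset D$. The sets are $Q_0=\{q\in\mathbb{R}^2:|q_1|,|q_2|>\sqrt{2\alpha\beta}\}$, $Q_{10}=\{q\in\mathbb{R}^2:|q_1|>|q_2|=\sqrt{2\alpha\beta}\}$, $Q_{20}=\{q\in\mathbb{R}^2:|q_2|>|q_1|=\sqrt{2\alpha\beta}\}$. *)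

theory Defs
  imports "HOL-Analysis.Analysis" "HOL-Probability.Essential_Supremum"
begin

text \<open>
  Elements of $L^p$ spaces are represented by functions, with equality almost everywhere
  written out explicitly. For functions on a set $D$ the measure is \<^term>\<open>lebesgue_on D\<close>,
  so that the values of a representative outside $D$ are irrelevant.
\<close>

definition Lp :: "'a measure \<Rightarrow> real \<Rightarrow> ('a \<Rightarrow> 'b::euclidean_space) set" where
  "Lp M p = {f \<in> borel_measurable M. integrable M (\<lambda>x. norm (f x) powr p)}"

definition Lp_norm :: "'a measure \<Rightarrow> real \<Rightarrow> ('a \<Rightarrow> 'b::euclidean_space) \<Rightarrow> real" where
  "Lp_norm M p f = (LINT x|M. norm (f x) powr p) powr (1 / p)"

definition Linf :: "'a measure \<Rightarrow> ('a \<Rightarrow> 'b::euclidean_space) set" where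
  "Linf M = {f \<in> borel_measurable M. esssup M (\<lambda>x. ennreal (norm (f x))) < \<infinity>}"

definition Linf_norm :: "'a measure \<Rightarrow> ('a \<Rightarrow> 'b::euclidean_space) \<Rightarrow> real" where
  "Linf_norm M f = enn2real (esssup M (\<lambda>x. ennreal (norm (f x))))"

abbreviation L2 :: "'a measure \<Rightarrow> ('a \<Rightarrow> 'b::euclidean_space) set" where
  "L2 M \<equiv> Lp M 2"

definition L2_inner ::
    "'a measure \<Rightarrow> ('a \<Rightarrow> 'b::euclidean_space) \<Rightarrow> ('a \<Rightarrow> 'b) \<Rightarrow> real" where
  "L2_inner M f g = (LINT x|M. f x \<bullet> g x)"

text \<open>
  Linearity together with the norm bound forces the operator to agree on functions that
  are equal almost everywhere.
\<close>

definition bounded_linear_L2 ::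
    "'a measure \<Rightarrow> (('a \<Rightarrow> 'b::euclidean_space) \<Rightarrow> 'y::real_normed_vector) \<Rightarrow> bool" where
  "bounded_linear_L2 M S \<longleftrightarrow>
     (\<forall>u\<in>L2 M. \<forall>v\<in>L2 M. S (\<lambda>x. u x + v x) = S u + S v) \<and>
     (\<forall>c. \<forall>u\<in>L2 M. S (\<lambda>x. c *\<^sub>R u x) = c *\<^sub>R S u) \<and>
     (\<exists>C. \<forall>u\<in>L2 M. norm (S u) \<le> C * Lp_norm M 2 u)"

definition is_adjoint_L2 ::
    "'a measure \<Rightarrow> (('a \<Rightarrow> 'b::euclidean_space) \<Rightarrow> 'y::real_inner) \<Rightarrow> ('y \<Rightarrow> 'a \<Rightarrow> 'b) \<Rightarrow> bool" where
  "is_adjoint_L2 M S S' \<longleftrightarrow>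
     (\<forall>y. S' y \<in> L2 M \<and> (\<forall>u\<in>L2 M. S u \<bullet> y = L2_inner M u (S' y)))"

text \<open>
  A normed space of functions is given by its set \<open>X\<close> of representatives and its norm
  \<open>nrm\<close>. The map \<open>j\<close> is the inclusion: it picks a representative of each element of the
  embedded space, and so is linear and injective up to null sets.
\<close>

definition continuously_embedded ::
    "'a measure \<Rightarrow> ('a \<Rightarrow> 'b::euclidean_space) set \<Rightarrow> (('a \<Rightarrow> 'b) \<Rightarrow> real) \<Rightarrow>
     ('v::real_normed_vector \<Rightarrow> 'a \<Rightarrow> 'b) \<Rightarrow> bool" where
  "continuously_embedded M X nrm j \<longleftrightarrow>
     (\<forall>v. j v \<in> X) \<and>
     (\<forall>v w. AE x in M. j (v + w) x = j v x + j w x) \<and>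
     (\<forall>c v. AE x in M. j (c *\<^sub>R v) x = c *\<^sub>R j v x) \<and>
     (\<forall>v. (AE x in M. j v x = 0) \<longrightarrow> v = 0) \<and>
     (\<exists>C. \<forall>v. nrm (j v) \<le> C * norm v)"

definition maps_continuously_into ::
    "'a measure \<Rightarrow> ('y::topological_space \<Rightarrow> 'a \<Rightarrow> 'b) \<Rightarrow>
     ('v::topological_space \<Rightarrow> 'a \<Rightarrow> 'b) \<Rightarrow> bool" where
  "maps_continuously_into M A j \<longleftrightarrow>
     (\<exists>T. continuous_on UNIV T \<and> (\<forall>y. AE x in M. j (T y) x = A y x))"

definition fenchel_conjugate_L2 ::
    "'a measure \<Rightarrow> (('a \<Rightarrow> 'b::euclidean_space) \<Rightarrow> real) \<Rightarrow> ('a \<Rightarrow> 'b) \<Rightarrow> ereal" where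
  "fenchel_conjugate_L2 M G p = (SUP u\<in>L2 M. ereal (L2_inner M u p - G u))"

definition subdifferential_L2 ::
    "'a measure \<Rightarrow> (('a \<Rightarrow> 'b::euclidean_space) \<Rightarrow> ereal) \<Rightarrow> ('a \<Rightarrow> 'b) \<Rightarrow> ('a \<Rightarrow> 'b) set" where
  "subdifferential_L2 M F p =
     {u \<in> L2 M. \<bar>F p\<bar> \<noteq> \<infinity> \<and>
        (\<forall>q\<in>L2 M. F p + ereal (L2_inner M u (\<lambda>x. q x - p x)) \<le> F q)}"

definition abs0 :: "real \<Rightarrow> real" where
  "abs0 t = (if t = 0 then 0 else 1)"

definition g_cost :: "real \<Rightarrow> real \<Rightarrow> real^2 \<Rightarrow> real" where
  "g_cost \<alpha> \<beta> v = \<alpha> / 2 * ((v$1)\<^sup>2 + (v$2)\<^sup>2) + \<beta> * abs0 (v$1 * v$2)"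

definition G_cost :: "'a measure \<Rightarrow> real \<Rightarrow> real \<Rightarrow> ('a \<Rightarrow> real^2) \<Rightarrow> real" where
  "G_cost M \<alpha> \<beta> u = (LINT x|M. g_cost \<alpha> \<beta> (u x))"

definition Q0 :: "real \<Rightarrow> real \<Rightarrow> (real^2) set" where
  "Q0 \<alpha> \<beta> = {q. \<bar>q$1\<bar> > sqrt (2 * \<alpha> * \<beta>) \<and> \<bar>q$2\<bar> > sqrt (2 * \<alpha> * \<beta>)}"

definition Q10 :: "real \<Rightarrow> real \<Rightarrow> (real^2) set" where
  "Q10 \<alpha> \<beta> = {q. \<bar>q$1\<bar> > \<bar>q$2\<bar> \<and> \<bar>q$2\<bar> = sqrt (2 * \<alpha> * \<beta>)}"

definition Q20 :: "real \<Rightarrow> real \<Rightarrow> (real^2) set" where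
  "Q20 \<alpha> \<beta> = {q. \<bar>q$2\<bar> > \<bar>q$1\<bar> \<and> \<bar>q$1\<bar> = sqrt (2 * \<alpha> * \<beta>)}"

definition free_arc :: "'a set \<Rightarrow> real \<Rightarrow> real \<Rightarrow> ('a \<Rightarrow> real^2) \<Rightarrow> 'a set" where
  "free_arc D \<alpha> \<beta> p = {x \<in> D. p x \<in> Q0 \<alpha> \<beta> \<union> Q10 \<alpha> \<beta> \<union> Q20 \<alpha> \<beta>}"

end

theory Submission
  imports Defs
begin

text \<open>
  Testing the subgradient inequality for \<open>\<G>\<^sub>\<beta>\<^sup>*\<close> at \<open>q = 0\<close> gives \<open>\<langle>u\<^sub>\<beta>, p\<^sub>\<beta>\<rangle> \<ge> 0\<close>, because
  \<open>\<G>\<^sub>\<beta>\<close> is nonnegative and vanishes at \<open>0\<close>, so that \<open>\<G>\<^sub>\<beta>\<^sup>*(0) = 0 \<le> \<G>\<^sub>\<beta>\<^sup>*(p\<^sub>\<beta>)\<close>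
  (\<open>subdifferential_conjugate_monotone_at_0\<close>). By the adjoint equation this says
  \<open>\<langle>S u\<^sub>\<beta>, S u\<^sub>\<beta> - z\<rangle> \<le> 0\<close>, and hence the residual satisfies \<open>\<parallel>S u\<^sub>\<beta> - z\<parallel> \<le> \<parallel>z\<parallel>\<close>
  uniformly in \<open>\<beta>\<close> (\<open>norm_residual_le\<close>).

  The adjoint is bounded from \<open>Y\<close> to \<open>V\<close> and \<open>V\<close> embeds into \<open>L\<^sup>\<infinity>\<close>
  (\<open>adjoint_essentially_bounded\<close>), so a constant independent of \<open>\<beta>\<close> bounds \<open>\<parallel>p\<^sub>\<beta>\<parallel>\<^sub>\<infinity>\<close>.
  On the free arc both components of \<open>p\<^sub>\<beta>\<close> have modulus at least
  \<open>sqrt (2 \<alpha> \<beta>)\<close>, and this threshold exceeds any fixed bound once \<open>\<beta>\<close> is large.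
\<close>

lemma L2_inner_commute: "L2_inner M f g = L2_inner M g f"
  by (simp add: L2_inner_def inner_commute)

lemma integrable_inner_L2:
  assumes "f \<in> L2 M" "g \<in> L2 M"
  shows "integrable M (\<lambda>x. f x \<bullet> g x)"
proof (rule Bochner_Integration.integrable_bound)
  have [measurable]: "f \<in> borel_measurable M" "g \<in> borel_measurable M"
    using assms by (auto simp: Lp_def)
  show "(\<lambda>x. f x \<bullet> g x) \<in> borel_measurable M" by measurable
  show "integrable M (\<lambda>x. norm (f x) powr 2 + norm (g x) powr 2)"
    using assms by (auto simp: Lp_def)
  have "\<bar>f x \<bullet> g x\<bar> \<le> (norm (f x))\<^sup>2 + (norm (g x))\<^sup>2" for x
  proof -
    have "\<bar>f x \<bullet> g x\<bar> \<le> norm (f x) * norm (g x)"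
      by (rule Cauchy_Schwarz_ineq2)
    moreover have "2 * norm (f x) * norm (g x) \<le> (norm (f x))\<^sup>2 + (norm (g x))\<^sup>2"
      by (rule sum_squares_bound)
    moreover have "0 \<le> norm (f x) * norm (g x)"
      by simp
    ultimately show ?thesis
      by linarith
  qed
  then show "AE x in M. norm (f x \<bullet> g x) \<le> norm (norm (f x) powr 2 + norm (g x) powr 2)"
    by (simp add: powr_numeral)
qed

text \<open>
  The difference \<open>S' (c y) - c S' y\<close> is orthogonal to both \<open>S' (c y)\<close> and \<open>S' y\<close>,
  hence to itself.
\<close>

lemma is_adjoint_L2_scaleR:
  assumes adj: "is_adjoint_L2 M S S'"
  shows "AE x in M. S' (c *\<^sub>R y) x = c *\<^sub>R S' y x"
proof -
  define w where "w = S' (c *\<^sub>R y)"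
  define v where "v = S' y"
  have L2: "w \<in> L2 M" "v \<in> L2 M"
    using adj by (auto simp: is_adjoint_L2_def w_def v_def)
  have inner_w: "L2_inner M f w = c * L2_inner M f v" if "f \<in> L2 M" for f
  proof -
    have "L2_inner M f w = S f \<bullet> (c *\<^sub>R y)" "L2_inner M f v = S f \<bullet> y"
      using adj that unfolding is_adjoint_L2_def w_def v_def by metis+
    then show ?thesis by simp
  qed
  note int = integrable_inner_L2[OF L2(1) L2(1)] integrable_inner_L2[OF L2(1) L2(2)]
    integrable_inner_L2[OF L2(2) L2(2)]
  have expand: "(norm (w x - c *\<^sub>R v x))\<^sup>2
      = w x \<bullet> w x - 2 * c * (w x \<bullet> v x) + c\<^sup>2 * (v x \<bullet> v x)" for x
    unfolding power2_norm_eq_inner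
    by (simp add: inner_diff_left inner_diff_right inner_commute power2_eq_square
        algebra_simps)
  have int_sq: "integrable M (\<lambda>x. (norm (w x - c *\<^sub>R v x))\<^sup>2)"
    unfolding expand using int by simp
  have "(LINT x|M. (norm (w x - c *\<^sub>R v x))\<^sup>2)
      = L2_inner M w w - 2 * c * L2_inner M w v + c\<^sup>2 * L2_inner M v v"
    unfolding expand L2_inner_def using int by simp
  also have "\<dots> = 0"
    using inner_w[OF L2(1)] inner_w[OF L2(2)] L2_inner_commute[of M v w]
    by (simp add: power2_eq_square algebra_simps)
  finally have "AE x in M. (norm (w x - c *\<^sub>R v x))\<^sup>2 = 0"
    using integral_nonneg_eq_0_iff_AE[OF int_sq] by simp
  then show ?thesis
    by (simp add: w_def v_def)
qed

lemma homogeneous_continuous_imp_bounded: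
  fixes T :: "'a::real_normed_vector \<Rightarrow> 'b::real_normed_vector"
  assumes hom: "\<And>c y. T (c *\<^sub>R y) = c *\<^sub>R T y"
    and cont: "isCont T 0"
  shows "\<exists>K\<ge>0. \<forall>y. norm (T y) \<le> K * norm y"
proof -
  have T0: "T 0 = 0"
    using hom[of 0 0] by simp
  from cont obtain d where d: "d > 0" "\<And>y. norm y < d \<Longrightarrow> norm (T y) < 1"
    unfolding continuous_at_eps_delta using T0
    by (auto simp: dist_norm dest: spec[of _ 1])
  have "norm (T y) \<le> (2 / d) * norm y" for y
  proof (cases "y = 0")
    case False
    define c where "c = d / (2 * norm y)"
    have c: "c > 0" "c * norm y = d / 2"
      using False d(1) by (auto simp: c_def)
    have "norm (T (c *\<^sub>R y)) < 1"
      using d c by auto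
    then have "c * norm (T y) < 1"
      using c(1) by (simp add: hom)
    then have "norm (T y) < 1 / c"
      using c(1) by (simp add: pos_less_divide_eq mult.commute)
    then show ?thesis
      by (simp add: c_def mult.commute)
  qed (simp add: T0)
  moreover have "2 / d \<ge> 0"
    using d(1) by simp
  ultimately show ?thesis
    by blast
qed

lemma Linf_AE_le_norm:
  assumes "f \<in> Linf M"
  shows "AE x in M. norm (f x) \<le> Linf_norm M f"
proof -
  have fin: "esssup M (\<lambda>x. ennreal (norm (f x))) < \<infinity>"
    using assms by (auto simp: Linf_def)
  then have eq: "esssup M (\<lambda>x. ennreal (norm (f x))) = ennreal (Linf_norm M f)"
    by (simp add: Linf_norm_def)
  have "AE x in M. ennreal (norm (f x)) \<le> esssup M (\<lambda>x. ennreal (norm (f x)))"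
    by (rule esssup_AE)
  then show ?thesis
    unfolding eq by eventually_elim (simp add: Linf_norm_def)
qed

text \<open>
  Continuity of the lift \<open>T\<close> of \<open>S'\<close> to the embedded space is only a local statement;
  homogeneity, which \<open>T\<close> inherits from \<open>S'\<close> because \<open>j\<close> is injective up to null sets,
  turns it into a bound.
\<close>

lemma adjoint_essentially_bounded:
  fixes S :: "('a \<Rightarrow> 'b::euclidean_space) \<Rightarrow> 'y::real_inner"
    and j :: "'v::real_normed_vector \<Rightarrow> 'a \<Rightarrow> 'b"
  assumes adj: "is_adjoint_L2 M S S'"
    and maps: "maps_continuously_into M S' j"
    and emb: "continuously_embedded M (Linf M) (Linf_norm M) j"
  shows "\<exists>K\<ge>0. \<forall>y. AE x in M. norm (S' y x) \<le> K * norm y"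
proof -
  obtain T where contT: "continuous_on UNIV T" and T: "\<And>y. AE x in M. j (T y) x = S' y x"
    using maps by (auto simp: maps_continuously_into_def)
  have jLinf: "\<And>v. j v \<in> Linf M"
    and jadd: "\<And>v w. AE x in M. j (v + w) x = j v x + j w x"
    and jscale: "\<And>c v. AE x in M. j (c *\<^sub>R v) x = c *\<^sub>R j v x"
    and jinj: "\<And>v. (AE x in M. j v x = 0) \<Longrightarrow> v = 0"
    using emb by (auto simp: continuously_embedded_def)
  obtain C where C: "\<And>v. Linf_norm M (j v) \<le> C * norm v"
    using emb by (auto simp: continuously_embedded_def)
  have hom: "T (c *\<^sub>R y) = c *\<^sub>R T y" for c y
  proof -
    have "AE x in M. j (T (c *\<^sub>R y) + (- c) *\<^sub>R T y) x = 0"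
      using jadd[of "T (c *\<^sub>R y)" "(- c) *\<^sub>R T y"] jscale[of "- c" "T y"]
        T[of y] T[of "c *\<^sub>R y"] is_adjoint_L2_scaleR[OF adj, of c y]
      by eventually_elim simp
    from jinj[OF this] show ?thesis
      by simp
  qed
  have "isCont T 0"
    using contT by (simp add: continuous_on_eq_continuous_at)
  then obtain K where K: "K \<ge> 0" "\<And>y. norm (T y) \<le> K * norm y"
    using homogeneous_continuous_imp_bounded[of T] hom by blast
  have "AE x in M. norm (S' y x) \<le> (\<bar>C\<bar> * K) * norm y" for y
  proof -
    have "Linf_norm M (j (T y)) \<le> \<bar>C\<bar> * norm (T y)"
      using C[of "T y"] mult_right_mono[OF abs_ge_self[of C] norm_ge_zero[of "T y"]]
      by linarith
    also have "\<dots> \<le> \<bar>C\<bar> * (K * norm y)"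
      using K by (intro mult_left_mono) auto
    finally have bd: "Linf_norm M (j (T y)) \<le> \<bar>C\<bar> * K * norm y"
      by (simp add: mult.assoc)
    show ?thesis
      using T[of y] Linf_AE_le_norm[OF jLinf, of "T y"]
      by eventually_elim (use bd in simp)
  qed
  then show ?thesis
    using K(1) by (intro exI[of _ "\<bar>C\<bar> * K"]) auto
qed

text \<open>
  The hypotheses make \<open>0\<close> a minimiser of \<open>G\<close>, hence of its conjugate; subgradients of a
  convex function with minimum at \<open>0\<close> point away from \<open>0\<close>.
\<close>

lemma subdifferential_conjugate_monotone_at_0:
  assumes u: "u \<in> subdifferential_L2 M (fenchel_conjugate_L2 M G) p"
    and G0: "G (\<lambda>x. 0) = 0"
    and Gnn: "\<And>v. v \<in> L2 M \<Longrightarrow> G v \<ge> 0"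
  shows "L2_inner M u p \<ge> 0"
proof -
  let ?F = "fenchel_conjugate_L2 M G"
  have zero: "(\<lambda>x. 0) \<in> L2 M"
    by (simp add: Lp_def)
  have "ereal (L2_inner M (\<lambda>x. 0) p - G (\<lambda>x. 0)) \<le> ?F p"
    unfolding fenchel_conjugate_L2_def by (rule SUP_upper[OF zero])
  then have Fp: "0 \<le> ?F p"
    by (simp add: G0 L2_inner_def zero_ereal_def)
  have F0: "?F (\<lambda>x. 0) \<le> 0"
    unfolding fenchel_conjugate_L2_def
    by (rule SUP_least) (simp add: L2_inner_def Gnn)
  have "?F p + ereal (L2_inner M u (\<lambda>x. 0 - p x)) \<le> ?F (\<lambda>x. 0)"
    using u unfolding subdifferential_L2_def by (auto dest!: bspec[OF _ zero])
  then have "?F p + ereal (L2_inner M u (\<lambda>x. 0 - p x)) \<le> 0"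
    using F0 by (rule order_trans)
  moreover have "L2_inner M u (\<lambda>x. 0 - p x) = - L2_inner M u p"
    by (simp add: L2_inner_def)
  ultimately show ?thesis
    using Fp by (cases "?F p") auto
qed

lemma G_cost_nonneg:
  assumes "\<alpha> \<ge> 0" "\<beta> \<ge> 0"
  shows "G_cost M \<alpha> \<beta> v \<ge> 0"
  unfolding G_cost_def
  by (rule integral_nonneg_AE) (use assms in \<open>simp add: g_cost_def abs0_def\<close>)

lemma G_cost_zero: "G_cost M \<alpha> \<beta> (\<lambda>x. 0) = 0"
  by (simp add: G_cost_def g_cost_def abs0_def)

lemma norm_residual_le:
  fixes s z :: "'y::real_inner"
  assumes "s \<bullet> (s - z) \<le> 0"
  shows "norm (s - z) \<le> norm z"
proof -
  have "(norm (s - z))\<^sup>2 = s \<bullet> (s - z) - z \<bullet> (s - z)"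
    by (simp add: power2_norm_eq_inner inner_diff_left)
  also have "\<dots> \<le> norm z * norm (s - z)"
    using assms Cauchy_Schwarz_ineq2[of z "s - z"] by linarith
  finally show ?thesis
    by (cases "s = z") (auto simp: power2_eq_square)
qed

lemma norm_adjoint_state_residual_le:
  fixes S :: "('a \<Rightarrow> 'b::euclidean_space) \<Rightarrow> 'y::real_inner"
  assumes adj: "is_adjoint_L2 M S S'"
    and L2: "u \<in> L2 M" "p \<in> L2 M"
    and p: "AE x in M. p x = - S' (S u - z) x"
    and nonneg: "L2_inner M u p \<ge> 0"
  shows "norm (S u - z) \<le> norm z"
proof (rule norm_residual_le)
  have [measurable]: "u \<in> borel_measurable M" "p \<in> borel_measurable M"
      "S' (S u - z) \<in> borel_measurable M"
    using L2 adj by (auto simp: Lp_def is_adjoint_L2_def)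
  have "L2_inner M u p = (LINT x|M. - (u x \<bullet> S' (S u - z) x))"
    unfolding L2_inner_def
  proof (rule integral_cong_AE)
    show "AE x in M. u x \<bullet> p x = - (u x \<bullet> S' (S u - z) x)"
      using p by eventually_elim simp
  qed measurable
  also have "\<dots> = - L2_inner M u (S' (S u - z))"
    by (simp add: L2_inner_def)
  also have "L2_inner M u (S' (S u - z)) = S u \<bullet> (S u - z)"
    using adj L2(1) by (simp add: is_adjoint_L2_def)
  finally show "S u \<bullet> (S u - z) \<le> 0"
    using nonneg by simp
qed

lemma free_arc_null_if_bounded:
  assumes D: "D \<in> sets lebesgue"
    and bd: "AE x in lebesgue_on D. norm (p x) \<le> K"
    and K: "K < sqrt (2 * \<alpha> * \<beta>)"
  shows "free_arc D \<alpha> \<beta> p \<in> null_sets lebesgue"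
proof -
  have large: "\<not> norm q \<le> K" if "q \<in> Q0 \<alpha> \<beta> \<union> Q10 \<alpha> \<beta> \<union> Q20 \<alpha> \<beta>" for q
  proof -
    have "sqrt (2 * \<alpha> * \<beta>) \<le> \<bar>q $ 1\<bar>"
      using that by (auto simp: Q0_def Q10_def Q20_def)
    then show ?thesis
      using K component_le_norm_cart[of q 1] by linarith
  qed
  have "AE x in lebesgue. x \<in> D \<longrightarrow> norm (p x) \<le> K"
    using bd D by (simp add: AE_restrict_space_iff)
  then have "AE x in lebesgue. x \<notin> free_arc D \<alpha> \<beta> p"
    by eventually_elim (use large in \<open>auto simp: free_arc_def\<close>)
  then have "negligible (free_arc D \<alpha> \<beta> p)"
    by (simp add: negligible_iff_null_sets completion.AE_iff_null_sets)
  then show ?thesis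
    by (simp add: negligible_iff_null_sets)
qed

theorem theorem4p4:
  fixes D :: "(real^'d) set"
    and S :: "(real^'d \<Rightarrow> real^2) \<Rightarrow> 'y::{real_inner, complete_space}"
    and Sstar :: "'y \<Rightarrow> real^'d \<Rightarrow> real^2"
    and z :: 'y
    and j :: "'v::banach \<Rightarrow> real^'d \<Rightarrow> real^2"
    and r \<alpha> :: real
    and u p :: "real \<Rightarrow> real^'d \<Rightarrow> real^2"
  assumes "D \<in> lmeasurable"
    and "bounded_linear_L2 (lebesgue_on D) S"
    and "is_adjoint_L2 (lebesgue_on D) S Sstar"
    and "r > 2"
    and "continuously_embedded (lebesgue_on D)
           (Lp (lebesgue_on D) r) (Lp_norm (lebesgue_on D) r) j"
    and "maps_continuously_into (lebesgue_on D) Sstar j"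
    and "\<alpha> > 0"
    and "\<And>\<beta>. \<beta> > 0 \<Longrightarrow> u \<beta> \<in> L2 (lebesgue_on D)"
    and "\<And>\<beta>. \<beta> > 0 \<Longrightarrow> p \<beta> \<in> L2 (lebesgue_on D)"
    and "\<And>\<beta>. \<beta> > 0 \<Longrightarrow> AE x in lebesgue_on D. p \<beta> x = - Sstar (S (u \<beta>) - z) x"
    and "\<And>\<beta>. \<beta> > 0 \<Longrightarrow> u \<beta> \<in> subdifferential_L2 (lebesgue_on D)
           (fenchel_conjugate_L2 (lebesgue_on D) (G_cost (lebesgue_on D) \<alpha> \<beta>)) (p \<beta>)"
    and "continuously_embedded (lebesgue_on D)
           (Linf (lebesgue_on D)) (Linf_norm (lebesgue_on D)) j"
  shows "\<exists>\<beta>\<^sub>0>0. \<forall>\<beta>\<ge>\<beta>\<^sub>0. free_arc D \<alpha> \<beta> (p \<beta>) \<in> null_sets lebesgue"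
proof -
  let ?M = "lebesgue_on D"
  note adj = assms(3) and \<alpha> = assms(7)
  obtain K where K: "K \<ge> 0" "\<And>y. AE x in ?M. norm (Sstar y x) \<le> K * norm y"
    using adjoint_essentially_bounded[OF adj assms(6) assms(12)] by blast
  define B where "B = K * norm z"
  have B: "B \<ge> 0"
    using K(1) by (simp add: B_def)
  have p_bd: "AE x in ?M. norm (p \<beta> x) \<le> B" if \<beta>: "\<beta> > 0" for \<beta>
  proof -
    have "L2_inner ?M (u \<beta>) (p \<beta>) \<ge> 0"
      using assms(11)[OF \<beta>] \<alpha> \<beta>
      by (intro subdifferential_conjugate_monotone_at_0[where G = "G_cost ?M \<alpha> \<beta>"]
          G_cost_nonneg G_cost_zero) auto
    then have "norm (S (u \<beta>) - z) \<le> norm z"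
      by (rule norm_adjoint_state_residual_le[OF adj assms(8)[OF \<beta>] assms(9)[OF \<beta>] assms(10)[OF \<beta>]])
    then have le: "K * norm (S (u \<beta>) - z) \<le> B"
      unfolding B_def using K(1) by (intro mult_left_mono)
    show ?thesis
      using assms(10)[OF \<beta>] K(2)[of "S (u \<beta>) - z"]
      by eventually_elim (use le in simp)
  qed
  \<comment> \<open>Chosen so that the threshold \<open>sqrt (2 \<alpha> \<beta>\<^sub>0)\<close> equals \<open>B + 1\<close>.\<close>
  define b where "b = (B + 1)\<^sup>2 / (2 * \<alpha>)"
  have b: "b > 0"
    using \<alpha> B by (simp add: b_def)
  have "free_arc D \<alpha> \<beta> (p \<beta>) \<in> null_sets lebesgue" if \<beta>: "\<beta> \<ge> b" for \<beta>
  proof (rule free_arc_null_if_bounded)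
    show "D \<in> sets lebesgue"
      using assms(1) by (rule fmeasurableD)
    show "AE x in ?M. norm (p \<beta> x) \<le> B"
      using p_bd b \<beta> by simp
    have "(B + 1)\<^sup>2 \<le> 2 * \<alpha> * \<beta>"
      using \<beta> \<alpha> by (simp add: b_def field_simps)
    then have "B + 1 \<le> sqrt (2 * \<alpha> * \<beta>)"
      by (rule real_le_rsqrt)
    then show "B < sqrt (2 * \<alpha> * \<beta>)"
      by simp
  qed
  with b show ?thesis
    by blast
qed

end
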